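(* Let $X$ be a connected weighted non-bipartite graph with vertex $u$ such that $0\in\Phi_{\mathbf e_u}(X)$. If $(E_0)_{u,u}>\frac12$, then $u$ is sedentary in $X$ and both copies $(0,u)$ and $(1,u)$ of $u$ are sedentary in $K_2\times X$. If $(E_0)_{u,u}=\frac12$, then $u$ is sedentary in $X$ if and only if its two copies $(0,u),(1,u)$ are sedentary in $K_2\times X$.
   Context: Graphs are simple, connected, undirected, with nonzero real edge weights; $A(X)$ is the weighted adjacency matrix with spectral decomposition $A(X)=\sum_\lambda\lambda E_\lambda$ over distinct eigenvalues, $E_\lambda$ the orthogonal projection onto the $\lambda$-eigenspace; $\Phi_{\mathbf e_u}(X)=\{\lambda:E_\lambda\mathbf e_u\ne0\}$. The bipartite double $K_2\times X$ is the weighted graph with vertex set $\{0,1\}\times V(X)$ and adjacency matrix $A(K_2)\otimes A(X)$; $(0,u),(1,u)$ are the two copies of $u$ (it is connected since $X$ is non-bipartite). With $U(t)=e^{itA}$, a vertex $u$ is sedentary if $\inf_{t>0}|U(t)_{u,u}|\ge C$ for some $0<C\le1$. *)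

theory Defs
  imports "HOL-Analysis.Analysis"
begin

text \<open>A weighted graph on the finite vertex type 'n is given by its weighted adjacency
matrix A :: real^'n^'n: symmetric, zero diagonal (simple), edge (i,j) iff A i j \<noteq> 0
(so edge weights are nonzero reals).\<close>

definition weighted_graph :: "real^'n^'n \<Rightarrow> bool" where
  "weighted_graph A \<longleftrightarrow> transpose A = A \<and> (\<forall>i. A $ i $ i = 0)"

definition adj :: "real^'n^'n \<Rightarrow> 'n \<Rightarrow> 'n \<Rightarrow> bool" where
  "adj A i j \<longleftrightarrow> A $ i $ j \<noteq> 0"

definition connected_graph :: "real^'n^'n \<Rightarrow> bool" where
  "connected_graph A \<longleftrightarrow> (\<forall>i j. (adj A)\<^sup>*\<^sup>* i j)"

definition bipartite :: "real^'n^'n \<Rightarrow> bool" where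
  "bipartite A \<longleftrightarrow> (\<exists>f :: 'n \<Rightarrow> bool. \<forall>i j. adj A i j \<longrightarrow> f i \<noteq> f j)"

text \<open>Orthogonal projection onto the \<lambda>-eigenspace of A (the zero matrix if \<lambda> is
not an eigenvalue, since then the eigenspace is {0}).\<close>

definition eigproj :: "real^'n^'n \<Rightarrow> real \<Rightarrow> real^'n^'n" where
  "eigproj A l = (THE P. P ** P = P \<and> transpose P = P \<and>
      range (\<lambda>x. P *v x) = {x. A *v x = l *\<^sub>R x})"

definition eigsupport :: "real^'n^'n \<Rightarrow> 'n \<Rightarrow> real set" where
  "eigsupport A u = {l. eigproj A l *v axis u 1 \<noteq> 0}"

primrec matpow :: "real^'n^'n \<Rightarrow> nat \<Rightarrow> real^'n^'n" where
  "matpow A 0 = mat 1"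
| "matpow A (Suc k) = A ** matpow A k"

text \<open>(u,v)-entry of U(t) = exp(i t A), via the exponential power series.\<close>

definition transition :: "real^'n^'n \<Rightarrow> real \<Rightarrow> 'n \<Rightarrow> 'n \<Rightarrow> complex" where
  "transition A t u v = (\<Sum>k. (\<i> * complex_of_real t) ^ k / of_nat (fact k)
                              * complex_of_real (matpow A k $ u $ v))"

definition sedentary :: "real^'n^'n \<Rightarrow> 'n \<Rightarrow> bool" where
  "sedentary A u \<longleftrightarrow> (\<exists>C. 0 < C \<and> C \<le> 1 \<and>
      (INF t\<in>{0<..}. cmod (transition A t u u)) \<ge> C)"

text \<open>Bipartite double K_2 \<times> X: vertex set {0,1} \<times> V(X), with 0 = False, 1 = True;
adjacency matrix A(K_2) \<otimes> A(X).\<close>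

definition bipartite_double :: "real^'n^'n \<Rightarrow> real^(bool \<times> 'n)^(bool \<times> 'n)" where
  "bipartite_double A = (\<chi> p q. (if fst p \<noteq> fst q then 1 else 0) * A $ snd p $ snd q)"

end

theory Submission
  imports Defs
begin

text \<open>Expanding in an orthonormal eigenbasis of A gives
  U(t)_uu = \<Sum>_b (b_u)^2 exp(i t \<mu>_b) with weights (b_u)^2 summing to 1, and the
  eigenvectors in the kernel contribute the constant e = (E_0)_uu. Hence
  Re U(t)_uu \<ge> e - (1 - e) = 2e - 1, and if e = 1/2, Cauchy-Schwarz on the remaining weights
  gives (Im U(t)_uu)^2 \<le> Re U(t)_uu. In K_2 \<times> X odd powers of the adjacency matrix
  vanish on the diagonal blocks, so the amplitude at either copy of u is the even part of the
  series, namely Re U(t)_uu. For e > 1/2 all three amplitudes are thus bounded below by 2e - 1;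
  for e = 1/2 a lower bound on |U(t)_uu| transfers to Re U(t)_uu, and conversely
  |Re U(t)_uu| \<le> |U(t)_uu|.\<close>

definition orthonormal_eigenbasis :: "('a::euclidean_space \<Rightarrow> 'a) \<Rightarrow> 'a set \<Rightarrow> bool" where
  "orthonormal_eigenbasis f B \<longleftrightarrow> finite B \<and> pairwise orthogonal B \<and> (\<forall>b\<in>B. norm b = 1)
     \<and> span B = UNIV \<and> (\<forall>b\<in>B. f b = (b \<bullet> f b) *\<^sub>R b)"

lemma self_adjoint_quadratic_form_add:
  fixes f :: "'a::real_inner \<Rightarrow> 'a"
  assumes "linear f" and adj: "\<And>x y. f x \<bullet> y = x \<bullet> f y"
  shows "(v + s *\<^sub>R r) \<bullet> f (v + s *\<^sub>R r) = v \<bullet> f v + 2 * s * (r \<bullet> f v) + s\<^sup>2 * (r \<bullet> f r)"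
proof -
  have "v \<bullet> f r = r \<bullet> f v" using adj[of v r] by (simp add: inner_commute)
  then show ?thesis
    by (simp add: linear_add[OF assms(1)] linear_scale[OF assms(1)] inner_add_left
        inner_add_right algebra_simps power2_eq_square)
qed

text \<open>A maximiser of the Rayleigh quotient on an invariant subspace is an eigenvector: if the
  residual r = f v - m v were nonzero, moving v a little in the direction r (which is orthogonal
  to v) would increase the quotient.\<close>

lemma Rayleigh_maximiser_eigenvector:
  fixes f :: "'a::real_inner \<Rightarrow> 'a"
  assumes "linear f" and adj: "\<And>x y. f x \<bullet> y = x \<bullet> f y"
    and S: "subspace S" and inv: "\<And>x. x \<in> S \<Longrightarrow> f x \<in> S"
    and vS: "v \<in> S" and nv: "norm v = 1"
    and max: "\<And>y. y \<in> S \<Longrightarrow> norm y = 1 \<Longrightarrow> y \<bullet> f y \<le> v \<bullet> f v"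
  shows "f v = (v \<bullet> f v) *\<^sub>R v"
proof -
  define m where "m = v \<bullet> f v"
  define r where "r = f v - m *\<^sub>R v"
  have vv: "v \<bullet> v = 1" using nv by (simp add: norm_eq_1)
  have rS: "r \<in> S" unfolding r_def using S inv vS by (simp add: subspace_diff subspace_scale)
  have rv: "r \<bullet> v = 0" unfolding r_def m_def using vv
    by (simp add: inner_diff_left inner_commute[of "f v" v])
  have homogeneous: "y \<bullet> f y \<le> m * (y \<bullet> y)" if "y \<in> S" for y
  proof (cases "y = 0")
    case True then show ?thesis by (simp add: linear_0[OF assms(1)])
  next
    case False
    define z where "z = (1 / norm y) *\<^sub>R y"
    have "z \<bullet> f z \<le> m"
      unfolding m_def using False S that by (intro max) (simp_all add: z_def subspace_scale)
    also have "z \<bullet> f z = (y \<bullet> f y) / (norm y)\<^sup>2"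
      unfolding z_def by (simp add: linear_scale[OF assms(1)] power2_eq_square)
    finally show ?thesis
      using False by (simp add: divide_le_eq power2_norm_eq_inner)
  qed
  define K where "K = m * (r \<bullet> r) - r \<bullet> f r"
  have perturb: "2 * s * (r \<bullet> r) \<le> s\<^sup>2 * K" for s
  proof -
    have "f v = r + m *\<^sub>R v" unfolding r_def by simp
    then have "r \<bullet> f v = r \<bullet> r" using rv by (simp add: inner_add_right)
    then have "m + 2 * s * (r \<bullet> r) + s\<^sup>2 * (r \<bullet> f r) = (v + s *\<^sub>R r) \<bullet> f (v + s *\<^sub>R r)"
      using self_adjoint_quadratic_form_add[OF assms(1,2), of v s r] by (simp add: m_def)
    also have "\<dots> \<le> m * ((v + s *\<^sub>R r) \<bullet> (v + s *\<^sub>R r))"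
      using S vS rS by (intro homogeneous) (simp add: subspace_add subspace_scale)
    also have "(v + s *\<^sub>R r) \<bullet> (v + s *\<^sub>R r) = 1 + s\<^sup>2 * (r \<bullet> r)"
      using vv rv by (simp add: inner_add_left inner_add_right inner_commute power2_eq_square)
    finally show ?thesis unfolding K_def by (simp add: algebra_simps)
  qed
  have "r \<bullet> r = 0"
  proof (rule ccontr)
    assume "r \<bullet> r \<noteq> 0"
    then have pos: "r \<bullet> r > 0" by (simp add: order_le_neq_trans)
    define s where "s = (r \<bullet> r) / (\<bar>K\<bar> + 1)"
    have s0: "s > 0" unfolding s_def using pos by simp
    have "2 * (r \<bullet> r) \<le> s * K"
      using perturb[of s] s0 by (simp add: power2_eq_square mult.assoc)
    also have "\<dots> < s * (\<bar>K\<bar> + 1)" using s0 by (simp add: abs_ge_self le_less_trans)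
    also have "\<dots> = r \<bullet> r" unfolding s_def by simp
    finally show False using pos by simp
  qed
  then show ?thesis unfolding r_def m_def by simp
qed

lemma self_adjoint_invariant_subspace_eigenbasis:
  fixes f :: "'a::euclidean_space \<Rightarrow> 'a"
  assumes "linear f" and adj: "\<And>x y. f x \<bullet> y = x \<bullet> f y"
  shows "subspace S \<Longrightarrow> (\<And>x. x \<in> S \<Longrightarrow> f x \<in> S) \<Longrightarrow>
    \<exists>B. B \<subseteq> S \<and> pairwise orthogonal B \<and> (\<forall>b\<in>B. norm b = 1) \<and> span B = S \<and>
        (\<forall>b\<in>B. f b = (b \<bullet> f b) *\<^sub>R b)"
proof (induction "dim S" arbitrary: S rule: less_induct)
  case less
  note S = less.prems(1) and inv = less.prems(2)
  show ?case
  proof (cases "S \<subseteq> {0}")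
    case True
    then have "S = {0}" using S subspace_0 by blast
    then show ?thesis by (intro exI[of _ "{}"]) auto
  next
    case False
    then obtain x where xS: "x \<in> S" and x0: "x \<noteq> 0" by blast
    define M where "M = S \<inter> sphere 0 1"
    have "compact M" unfolding M_def
      by (rule closed_Int_compact[OF closed_subspace[OF S] compact_sphere])
    moreover have "(1 / norm x) *\<^sub>R x \<in> M"
      unfolding M_def using xS x0 S by (simp add: subspace_scale)
    moreover have "continuous_on M (\<lambda>y. y \<bullet> f y)"
      using assms(1) by (intro continuous_intros linear_continuous_on)
        (simp add: linear_conv_bounded_linear)
    ultimately obtain v where vM: "v \<in> M" and vmax: "\<forall>y\<in>M. y \<bullet> f y \<le> v \<bullet> f v"
      using continuous_attains_sup[of M "\<lambda>y. y \<bullet> f y"] by blast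
    have vS: "v \<in> S" and nv: "norm v = 1" using vM unfolding M_def by auto
    have fv: "f v = (v \<bullet> f v) *\<^sub>R v"
      using vmax unfolding M_def by (intro Rayleigh_maximiser_eigenvector[OF assms S inv vS nv]) auto
    have vv: "v \<bullet> v = 1" using nv by (simp add: norm_eq_1)
    define S' where "S' = {y \<in> S. y \<bullet> v = 0}"
    have S': "subspace S'" unfolding S'_def subspace_def using S
      by (auto simp: subspace_0 subspace_add subspace_scale inner_add_left)
    have S'_inv: "f y \<in> S'" if "y \<in> S'" for y
    proof -
      have "f y \<bullet> v = (v \<bullet> f v) * (y \<bullet> v)" by (subst adj, subst fv) simp
      then show ?thesis using that inv unfolding S'_def by auto
    qed
    have "v \<notin> S'" using vv unfolding S'_def by auto
    then have "S' \<subset> S" using vS unfolding S'_def by blast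
    then have "dim S' < dim S"
      using S S' by (intro dim_psubset) (simp add: span_eq_iff[THEN iffD2])
    then obtain B' where B': "B' \<subseteq> S'" "pairwise orthogonal B'" "\<forall>b\<in>B'. norm b = 1"
       "span B' = S'" "\<forall>b\<in>B'. f b = (b \<bullet> f b) *\<^sub>R b"
      using less.hyps[OF _ S' S'_inv] by blast
    show ?thesis
    proof (intro exI[of _ "insert v B'"] conjI)
      show "insert v B' \<subseteq> S" using vS B'(1) unfolding S'_def by auto
      show "pairwise orthogonal (insert v B')"
        using B'(1,2) unfolding pairwise_insert S'_def orthogonal_def
        by (auto simp: inner_commute)
      show "\<forall>b\<in>insert v B'. norm b = 1" using nv B'(3) by auto
      show "\<forall>b\<in>insert v B'. f b = (b \<bullet> f b) *\<^sub>R b" using B'(5) fv by auto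
      show "span (insert v B') = S"
      proof
        show "span (insert v B') \<subseteq> S"
          using vS B'(1) by (intro span_minimal[OF _ S]) (auto simp: S'_def)
        show "S \<subseteq> span (insert v B')"
        proof
          fix y assume y: "y \<in> S"
          have "y - (y \<bullet> v) *\<^sub>R v \<in> span B'"
            unfolding B'(4) S'_def using y vS S vv
            by (simp add: subspace_diff subspace_scale inner_diff_left)
          then have "(y - (y \<bullet> v) *\<^sub>R v) + (y \<bullet> v) *\<^sub>R v \<in> span (insert v B')"
            by (intro span_add) (auto intro: span_mono[THEN subsetD] span_base span_scale)
          then show "y \<in> span (insert v B')" by simp
        qed
      qed
    qed
  qed
qed

theorem self_adjoint_orthonormal_eigenbasis:
  fixes f :: "'a::euclidean_space \<Rightarrow> 'a"
  assumes "linear f" and "\<And>x y. f x \<bullet> y = x \<bullet> f y"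
  obtains B where "orthonormal_eigenbasis f B"
proof -
  obtain B where B: "pairwise orthogonal B" "\<forall>b\<in>B. norm b = 1" "span B = UNIV"
    "\<forall>b\<in>B. f b = (b \<bullet> f b) *\<^sub>R b"
    using self_adjoint_invariant_subspace_eigenbasis[OF assms, of UNIV] by auto
  have "0 \<notin> B" using B(2) by force
  then have "finite B"
    using B(1) by (intro finiteI_independent pairwise_orthogonal_independent)
  then show ?thesis using that B unfolding orthonormal_eigenbasis_def by blast
qed

lemma symmetric_matrix_self_adjoint:
  fixes A :: "real^'n^'n"
  assumes "transpose A = A"
  shows "(A *v x) \<bullet> y = x \<bullet> (A *v y)"
  by (metis assms dot_lmul_matrix inner_commute vector_transpose_matrix)

lemma symmetric_matrix_orthonormal_eigenbasis:
  fixes A :: "real^'n^'n"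
  assumes "transpose A = A"
  obtains B where "orthonormal_eigenbasis ((*v) A) B"
  using self_adjoint_orthonormal_eigenbasis[of "(*v) A"] symmetric_matrix_self_adjoint[OF assms]
  by (metis matrix_vector_mul_linear)

lemma orthonormal_eigenbasis_expand:
  assumes "orthonormal_eigenbasis f B"
  shows "x = (\<Sum>b\<in>B. (b \<bullet> x) *\<^sub>R b)"
  using orthonormal_basis_expand[of B x] assms
  unfolding orthonormal_eigenbasis_def by (simp add: inner_commute)

lemma matpow_mult_eigenbasis:
  fixes A :: "real^'n^'n"
  assumes B: "orthonormal_eigenbasis ((*v) A) B"
  shows "matpow A k *v x = (\<Sum>b\<in>B. ((b \<bullet> (A *v b))^k * (b \<bullet> x)) *\<^sub>R b)"
proof (induction k)
  case 0
  then show ?case using orthonormal_eigenbasis_expand[OF B, of x] by simp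
next
  case (Suc k)
  have "matpow A (Suc k) *v x = A *v (matpow A k *v x)"
    by (simp add: matrix_vector_mul_assoc)
  also have "\<dots> = (\<Sum>b\<in>B. ((b \<bullet> (A *v b))^k * (b \<bullet> x)) *\<^sub>R (A *v b))"
    unfolding Suc by (simp add: linear_sum[OF matrix_vector_mul_linear] matrix_vector_mult_scaleR)
  also have "\<dots> = (\<Sum>b\<in>B. ((b \<bullet> (A *v b))^Suc k * (b \<bullet> x)) *\<^sub>R b)"
  proof (rule sum.cong)
    fix b assume "b \<in> B"
    then have "A *v b = (b \<bullet> (A *v b)) *\<^sub>R b" using B unfolding orthonormal_eigenbasis_def by blast
    then show "((b \<bullet> (A *v b))^k * (b \<bullet> x)) *\<^sub>R (A *v b) = ((b \<bullet> (A *v b))^Suc k * (b \<bullet> x)) *\<^sub>R b"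
      by (metis (no_types, lifting) mult.assoc mult.commute power_Suc scaleR_scaleR)
  qed simp
  finally show ?case .
qed

lemma matpow_entry_eigenbasis:
  fixes A :: "real^'n^'n"
  assumes "orthonormal_eigenbasis ((*v) A) B"
  shows "matpow A k $ u $ v = (\<Sum>b\<in>B. (b \<bullet> (A *v b))^k * (b $ u * b $ v))"
proof -
  have "matpow A k $ u $ v = (matpow A k *v axis v 1) $ u"
    by (simp add: matrix_vector_mult_def axis_def if_distrib cong: if_cong)
  then show ?thesis
    unfolding matpow_mult_eigenbasis[OF assms] by (simp add: inner_axis mult_ac)
qed

lemma sum_square_entries_eigenbasis:
  fixes A :: "real^'n^'n"
  assumes "orthonormal_eigenbasis ((*v) A) B"
  shows "(\<Sum>b\<in>B. (b $ u)\<^sup>2) = 1"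
  using matpow_entry_eigenbasis[OF assms, of 0 u u] by (simp add: mat_def power2_eq_square)

lemma transition_series_sums:
  fixes A :: "real^'n^'n"
  assumes "orthonormal_eigenbasis ((*v) A) B"
  shows "(\<lambda>k. (\<i> * of_real t) ^ k / of_nat (fact k) * of_real (matpow A k $ u $ v))
     sums (\<Sum>b\<in>B. of_real (b $ u * b $ v) * exp (\<i> * of_real (t * (b \<bullet> (A *v b)))))"
proof -
  have "(\<lambda>k. \<Sum>b\<in>B. of_real (b $ u * b $ v) * ((\<i> * of_real (t * (b \<bullet> (A *v b))))^k /\<^sub>R fact k))
     sums (\<Sum>b\<in>B. of_real (b $ u * b $ v) * exp (\<i> * of_real (t * (b \<bullet> (A *v b)))))"
    by (intro sums_sum sums_mult exp_converges)
  also have "(\<lambda>k. \<Sum>b\<in>B. of_real (b $ u * b $ v) * ((\<i> * of_real (t * (b \<bullet> (A *v b))))^k /\<^sub>R fact k))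
     = (\<lambda>k. (\<i> * of_real t) ^ k / of_nat (fact k) * of_real (matpow A k $ u $ v))"
    unfolding matpow_entry_eigenbasis[OF assms] of_real_sum sum_distrib_left
    by (intro ext sum.cong) (simp_all add: power_mult_distrib scaleR_conv_of_real field_simps)
  finally show ?thesis .
qed

lemma transition_eigenbasis:
  fixes A :: "real^'n^'n"
  assumes "orthonormal_eigenbasis ((*v) A) B"
  shows "transition A t u v = (\<Sum>b\<in>B. of_real (b $ u * b $ v) * exp (\<i> * of_real (t * (b \<bullet> (A *v b)))))"
  unfolding transition_def using transition_series_sums[OF assms] by (rule sums_unique[symmetric])

lemma outer_product_sum_mult_vector:
  fixes S :: "(real^'n) set"
  shows "(\<chi> i j. \<Sum>b\<in>S. b $ i * b $ j) *v x = (\<Sum>b\<in>S. (b \<bullet> x) *\<^sub>R b)"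
proof -
  have "(\<Sum>j\<in>UNIV. (\<Sum>b\<in>S. b $ i * b $ j) * x $ j) = (\<Sum>b\<in>S. (b \<bullet> x) * b $ i)" for i
  proof -
    have "(\<Sum>j\<in>UNIV. (\<Sum>b\<in>S. b $ i * b $ j) * x $ j) = (\<Sum>j\<in>UNIV. \<Sum>b\<in>S. b $ i * b $ j * x $ j)"
      by (simp only: sum_distrib_right)
    also have "\<dots> = (\<Sum>b\<in>S. \<Sum>j\<in>UNIV. b $ i * b $ j * x $ j)"
      by (rule sum.swap)
    also have "\<dots> = (\<Sum>b\<in>S. (b \<bullet> x) * b $ i)"
      by (simp add: inner_vec_def sum_distrib_left mult_ac)
    finally show ?thesis .
  qed
  then show ?thesis by (simp add: vec_eq_iff matrix_vector_mult_def)
qed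

lemma orthogonal_projection_residual:
  fixes P :: "real^'n^'n"
  assumes "P ** P = P" "transpose P = P"
  shows "(x - P *v x) \<bullet> (P *v y) = 0"
proof -
  have "(P *v x) \<bullet> (P *v y) = x \<bullet> (P *v (P *v y))"
    using symmetric_matrix_self_adjoint[OF assms(2)] by blast
  also have "\<dots> = x \<bullet> (P *v y)" by (simp add: matrix_vector_mul_assoc assms(1))
  finally show ?thesis by (simp add: inner_diff_left)
qed

lemma orthogonal_projection_unique:
  fixes P Q :: "real^'n^'n"
  assumes P: "P ** P = P" "transpose P = P" and Q: "Q ** Q = Q" "transpose Q = Q"
    and range_eq: "range ((*v) P) = range ((*v) Q)"
  shows "P = Q"
proof -
  have "P *v x = Q *v x" for x
  proof -
    define d where "d = P *v x - Q *v x"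
    obtain y where "P *v x = Q *v y" using range_eq by (metis rangeE rangeI)
    then have dQ: "d = Q *v (y - x)" unfolding d_def by (simp add: matrix_vector_mult_diff_distrib)
    then obtain z where dP: "d = P *v z" using range_eq by (metis rangeE rangeI)
    have "(x - Q *v x) \<bullet> d = 0" unfolding dQ by (rule orthogonal_projection_residual[OF Q])
    moreover have "(x - P *v x) \<bullet> d = 0" unfolding dP by (rule orthogonal_projection_residual[OF P])
    moreover have "d = (x - Q *v x) - (x - P *v x)" unfolding d_def by simp
    ultimately have "d \<bullet> d = 0" by (metis inner_diff_left diff_self)
    then show ?thesis unfolding d_def by simp
  qed
  then show ?thesis by (simp add: matrix_eq)
qed

lemma eigproj_eigenbasis:
  fixes A :: "real^'n^'n"
  assumes sym: "transpose A = A" and B: "orthonormal_eigenbasis ((*v) A) B"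
  shows "eigproj A l = (\<chi> i j. \<Sum>b\<in>{b\<in>B. b \<bullet> (A *v b) = l}. b $ i * b $ j)"
    (is "_ = ?P")
proof -
  let ?Bl = "{b\<in>B. b \<bullet> (A *v b) = l}"
  have eig: "A *v b = (b \<bullet> (A *v b)) *\<^sub>R b" if "b \<in> B" for b
    using B that unfolding orthonormal_eigenbasis_def by blast
  have P_mult: "?P *v x = (\<Sum>b\<in>?Bl. (b \<bullet> x) *\<^sub>R b)" for x
    by (rule outer_product_sum_mult_vector)
  have fixes_eigenspace: "?P *v z = z" if z: "A *v z = l *\<^sub>R z" for z
  proof -
    have "z = (\<Sum>b\<in>B. (b \<bullet> z) *\<^sub>R b)" by (rule orthonormal_eigenbasis_expand[OF B])
    also have "\<dots> = (\<Sum>b\<in>?Bl. (b \<bullet> z) *\<^sub>R b)"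
    proof (rule sum.mono_neutral_right)
      show "finite B" using B unfolding orthonormal_eigenbasis_def by blast
      show "\<forall>b\<in>B - ?Bl. (b \<bullet> z) *\<^sub>R b = 0"
      proof
        fix b assume b: "b \<in> B - ?Bl"
        define \<mu> where "\<mu> = b \<bullet> (A *v b)"
        have "\<mu> * (b \<bullet> z) = (A *v b) \<bullet> z"
          using eig[of b] b unfolding \<mu>_def[symmetric] by simp
        also have "\<dots> = l * (b \<bullet> z)"
          unfolding symmetric_matrix_self_adjoint[OF sym] z by simp
        finally have "(\<mu> - l) * (b \<bullet> z) = 0" by (simp add: algebra_simps)
        then show "(b \<bullet> z) *\<^sub>R b = 0" using b by (simp add: \<mu>_def)
      qed
    qed auto
    finally show ?thesis unfolding P_mult by simp
  qed
  have into_eigenspace: "A *v (?P *v x) = l *\<^sub>R (?P *v x)" for x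
  proof -
    have "A *v (?P *v x) = (\<Sum>b\<in>?Bl. (b \<bullet> x) *\<^sub>R (A *v b))"
      unfolding P_mult by (simp add: linear_sum[OF matrix_vector_mul_linear] matrix_vector_mult_scaleR)
    also have "\<dots> = (\<Sum>b\<in>?Bl. (b \<bullet> x) *\<^sub>R (l *\<^sub>R b))"
      using eig by (intro sum.cong) (auto simp del: scaleR_scaleR)
    finally show ?thesis unfolding P_mult by (simp add: scaleR_sum_right mult.commute)
  qed
  have P: "?P ** ?P = ?P" "transpose ?P = ?P" "range ((*v) ?P) = {x. A *v x = l *\<^sub>R x}"
  proof -
    show "?P ** ?P = ?P"
    proof (rule matrix_eq[THEN iffD2], rule allI)
      fix x
      have "?P *v (?P *v x) = ?P *v x" by (rule fixes_eigenspace[OF into_eigenspace])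
      then show "(?P ** ?P) *v x = ?P *v x" by (simp only: matrix_vector_mul_assoc)
    qed
    show "transpose ?P = ?P"
      unfolding transpose_def by (simp add: vec_eq_iff mult.commute)
    show "range ((*v) ?P) = {x. A *v x = l *\<^sub>R x}"
    proof (intro set_eqI iffI)
      fix y assume "y \<in> range ((*v) ?P)"
      then obtain x where "y = ?P *v x" by blast
      then show "y \<in> {x. A *v x = l *\<^sub>R x}" using into_eigenspace by simp
    next
      fix y assume "y \<in> {x. A *v x = l *\<^sub>R x}"
      then have "y = ?P *v y" using fixes_eigenspace by simp
      then show "y \<in> range ((*v) ?P)" by (rule range_eqI)
    qed
  qed
  show ?thesis
    unfolding eigproj_def
  proof (rule the_equality)
    fix Q assume "Q ** Q = Q \<and> transpose Q = Q \<and> range ((*v) Q) = {x. A *v x = l *\<^sub>R x}"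
    then have Q: "Q ** Q = Q" "transpose Q = Q" "range ((*v) Q) = range ((*v) ?P)"
      unfolding P(3) by blast+
    show "Q = ?P" by (rule orthogonal_projection_unique[OF Q(1,2) P(1,2) Q(3)])
  qed (intro conjI P)
qed

lemma bipartite_double_entry:
  "bipartite_double A $ (c, v) $ (d, w) = (if c = d then 0 else A $ v $ w)"
  by (simp add: bipartite_double_def)

lemma matpow_bipartite_double:
  fixes A :: "real^'n^'n"
  shows "matpow (bipartite_double A) k $ (c, v) $ (c', v') =
     (if even k \<longleftrightarrow> c = c' then matpow A k $ v $ v' else 0)"
proof (induction k arbitrary: c v)
  case 0
  then show ?case by (simp add: mat_def)
next
  case (Suc k)
  have "matpow (bipartite_double A) (Suc k) $ (c, v) $ (c', v') =
    (\<Sum>d\<in>UNIV. \<Sum>w\<in>UNIV. bipartite_double A $ (c, v) $ (d, w) * matpow (bipartite_double A) k $ (d, w) $ (c', v'))"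
    by (simp add: matrix_matrix_mult_def sum.cartesian_product flip: UNIV_Times_UNIV)
  also have "\<dots> = (if even (Suc k) \<longleftrightarrow> c = c' then matpow A (Suc k) $ v $ v' else 0)"
    unfolding Suc.IH by (cases c; cases c') (simp_all add: UNIV_bool bipartite_double_entry matrix_matrix_mult_def)
  finally show ?case .
qed

lemma Re_exp_series_term:
  fixes t c :: real
  shows "of_real (Re ((\<i> * of_real t) ^ k / of_nat (fact k) * of_real c)) =
     (if even k then (\<i> * of_real t) ^ k / of_nat (fact k) * of_real c else 0)"
proof (cases "even k")
  case True
  then obtain m where "k = 2 * m" by blast
  then have "(\<i> * of_real t) ^ k / of_nat (fact k) * of_real c = of_real ((- (t\<^sup>2)) ^ m / fact k * c)"
    by (simp add: power_mult power_mult_distrib)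
  then show ?thesis using True by (simp only: Re_complex_of_real if_True)
next
  case False
  then obtain m where "k = 2 * m + 1" using oddE by blast
  then have "(\<i> * of_real t) ^ k = \<i> * of_real (t * (- (t\<^sup>2)) ^ m)"
    by (simp add: power_mult power_mult_distrib power_add)
  then have "(\<i> * of_real t) ^ k / of_nat (fact k) * of_real c = \<i> * of_real (t * (- (t\<^sup>2)) ^ m / fact k * c)"
    by simp
  then show ?thesis using False by (simp only: Re_i_times Im_complex_of_real) simp
qed

lemma transition_bipartite_double:
  fixes A :: "real^'n^'n"
  assumes "transpose A = A"
  shows "transition (bipartite_double A) t (c, u) (c, v) = of_real (Re (transition A t u v))"
proof -
  obtain B where "orthonormal_eigenbasis ((*v) A) B"
    using symmetric_matrix_orthonormal_eigenbasis[OF assms] .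
  then have "(\<lambda>k. (\<i> * of_real t) ^ k / of_nat (fact k) * of_real (matpow A k $ u $ v))
      sums transition A t u v"
    unfolding transition_def by (intro summable_sums sums_summable[OF transition_series_sums])
  then have "(\<lambda>k. complex_of_real (Re ((\<i> * of_real t) ^ k / of_nat (fact k) * of_real (matpow A k $ u $ v))))
      sums complex_of_real (Re (transition A t u v))"
    by (simp add: sums_complex_iff)
  then show ?thesis
    unfolding transition_def Re_exp_series_term matpow_bipartite_double
    by (simp add: if_distrib sums_unique[symmetric] cong: if_cong)
qed

lemma transition_diag_split_kernel:
  fixes A :: "real^'n^'n"
  assumes "transpose A = A"
  obtains B :: "(real^'n) set" and a \<mu> :: "real^'n \<Rightarrow> real"
  where "finite B" "\<forall>b\<in>B. 0 \<le> a b" "(\<Sum>b\<in>B. a b) = 1 - eigproj A 0 $ u $ u"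
    "\<And>t. Re (transition A t u u) = eigproj A 0 $ u $ u + (\<Sum>b\<in>B. a b * cos (t * \<mu> b))"
    "\<And>t. Im (transition A t u u) = (\<Sum>b\<in>B. a b * sin (t * \<mu> b))"
proof -
  obtain B where B: "orthonormal_eigenbasis ((*v) A) B"
    using symmetric_matrix_orthonormal_eigenbasis[OF assms] .
  define \<mu> where "\<mu> b = b \<bullet> (A *v b)" for b :: "real^'n"
  define a where "a b = (b $ u)\<^sup>2" for b :: "real^'n"
  define K where "K = {b\<in>B. \<mu> b = 0}"
  have fin: "finite B" using B unfolding orthonormal_eigenbasis_def by blast
  have split: "(\<Sum>b\<in>B. f b) = (\<Sum>b\<in>B - K. f b) + (\<Sum>b\<in>K. f b)" for f :: "real^'n \<Rightarrow> real"
    using fin by (intro sum.subset_diff) (auto simp: K_def)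
  have e: "eigproj A 0 $ u $ u = (\<Sum>b\<in>K. a b)"
    unfolding eigproj_eigenbasis[OF assms B] K_def a_def \<mu>_def by (simp add: power2_eq_square)
  have T: "transition A t u u = (\<Sum>b\<in>B. of_real (a b) * exp (\<i> * of_real (t * \<mu> b)))" for t
    unfolding transition_eigenbasis[OF B] a_def \<mu>_def by (simp add: power2_eq_square)
  show ?thesis
  proof (rule that[of "B - K" a \<mu>])
    show "finite (B - K)" using fin by simp
    show "\<forall>b\<in>B - K. 0 \<le> a b" unfolding a_def by simp
    show "(\<Sum>b\<in>B - K. a b) = 1 - eigproj A 0 $ u $ u"
      using split[of a] sum_square_entries_eigenbasis[OF B, of u] unfolding e a_def by simp
    show "Re (transition A t u u) = eigproj A 0 $ u $ u + (\<Sum>b\<in>B - K. a b * cos (t * \<mu> b))" for t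
      unfolding T Re_sum e by (simp add: split Re_exp K_def)
    show "Im (transition A t u u) = (\<Sum>b\<in>B - K. a b * sin (t * \<mu> b))" for t
      unfolding T Im_sum by (simp add: split Im_exp K_def)
  qed
qed

lemma weighted_Cauchy_Schwarz:
  fixes a x :: "'b \<Rightarrow> real"
  assumes "\<forall>i\<in>I. 0 \<le> a i"
  shows "(\<Sum>i\<in>I. a i * x i)\<^sup>2 \<le> (\<Sum>i\<in>I. a i) * (\<Sum>i\<in>I. a i * (x i)\<^sup>2)"
proof -
  have "(\<Sum>i\<in>I. a i * x i) = (\<Sum>i\<in>I. sqrt (a i) * (sqrt (a i) * x i))"
    using assms by (intro sum.cong) (simp_all flip: mult.assoc)
  also have "(\<dots>)\<^sup>2 \<le> (\<Sum>i\<in>I. (sqrt (a i))\<^sup>2) * (\<Sum>i\<in>I. (sqrt (a i) * x i)\<^sup>2)"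
    by (rule Cauchy_Schwarz_ineq_sum)
  also have "\<dots> = (\<Sum>i\<in>I. a i) * (\<Sum>i\<in>I. a i * (x i)\<^sup>2)"
    using assms by (simp add: power_mult_distrib)
  finally show ?thesis .
qed

lemma sin_squared_le_2_1_plus_cos: "(sin x)\<^sup>2 \<le> 2 * (1 + cos (x::real))"
proof -
  have "(sin x)\<^sup>2 = (1 - cos x) * (1 + cos x)"
    using sin_cos_squared_add[of x] by (simp add: power2_eq_square algebra_simps)
  also have "\<dots> \<le> 2 * (1 + cos x)"
    using cos_ge_minus_one[of x] cos_le_one[of x] by (intro mult_right_mono) linarith+
  finally show ?thesis .
qed

lemma weighted_sin_sum_squared_le:
  fixes a \<theta> :: "'b \<Rightarrow> real"
  assumes "\<forall>i\<in>I. 0 \<le> a i"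
  shows "(\<Sum>i\<in>I. a i * sin (\<theta> i))\<^sup>2 \<le> 2 * (\<Sum>i\<in>I. a i) * (\<Sum>i\<in>I. a i * (1 + cos (\<theta> i)))"
proof -
  have "(\<Sum>i\<in>I. a i * sin (\<theta> i))\<^sup>2 \<le> (\<Sum>i\<in>I. a i) * (\<Sum>i\<in>I. a i * (sin (\<theta> i))\<^sup>2)"
    by (rule weighted_Cauchy_Schwarz[OF assms])
  also have "\<dots> \<le> (\<Sum>i\<in>I. a i) * (\<Sum>i\<in>I. a i * (2 * (1 + cos (\<theta> i))))"
    using assms sin_squared_le_2_1_plus_cos
    by (intro mult_left_mono sum_mono sum_nonneg) auto
  finally show ?thesis by (simp add: sum_distrib_left mult_ac)
qed

lemma Re_transition_diag_ge:
  fixes A :: "real^'n^'n"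
  assumes "transpose A = A"
  shows "2 * eigproj A 0 $ u $ u - 1 \<le> Re (transition A t u u)"
proof -
  obtain B and a \<mu> :: "real^'n \<Rightarrow> real" where "finite B" and a: "\<forall>b\<in>B. 0 \<le> a b"
    and sum_a: "(\<Sum>b\<in>B. a b) = 1 - eigproj A 0 $ u $ u"
    and Re: "\<And>t. Re (transition A t u u) = eigproj A 0 $ u $ u + (\<Sum>b\<in>B. a b * cos (t * \<mu> b))"
    and "\<And>t. Im (transition A t u u) = (\<Sum>b\<in>B. a b * sin (t * \<mu> b))"
    using transition_diag_split_kernel[OF assms, of u] by blast
  have "(\<Sum>b\<in>B. - a b) \<le> (\<Sum>b\<in>B. a b * cos (t * \<mu> b))"
    using a by (intro sum_mono) (metis cos_ge_minus_one mult_left_mono mult_minus1_right)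
  then show ?thesis unfolding Re using sum_a by (simp add: sum_negf)
qed

lemma Im_transition_diag_squared_le_Re:
  fixes A :: "real^'n^'n"
  assumes "transpose A = A" and "eigproj A 0 $ u $ u = 1/2"
  shows "(Im (transition A t u u))\<^sup>2 \<le> Re (transition A t u u)"
proof -
  obtain B and a \<mu> :: "real^'n \<Rightarrow> real" where "finite B" and a: "\<forall>b\<in>B. 0 \<le> a b"
    and sum_a: "(\<Sum>b\<in>B. a b) = 1 - eigproj A 0 $ u $ u"
    and Re: "\<And>t. Re (transition A t u u) = eigproj A 0 $ u $ u + (\<Sum>b\<in>B. a b * cos (t * \<mu> b))"
    and Im: "\<And>t. Im (transition A t u u) = (\<Sum>b\<in>B. a b * sin (t * \<mu> b))"
    using transition_diag_split_kernel[OF assms(1), of u] by blast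
  show ?thesis
    using weighted_sin_sum_squared_le[OF a, of "\<lambda>b. t * \<mu> b"]
    unfolding Re Im by (simp add: algebra_simps sum.distrib sum_a assms(2))
qed

lemma sedentary_iff:
  "sedentary M v \<longleftrightarrow> (\<exists>C>0. \<forall>t>0. C \<le> cmod (transition M t v v))"
proof
  assume "sedentary M v"
  then obtain C where "0 < C" and C: "C \<le> (INF t\<in>{0<..}. cmod (transition M t v v))"
    unfolding sedentary_def by blast
  moreover have "(INF t\<in>{0<..}. cmod (transition M t v v)) \<le> cmod (transition M t v v)" if "t > 0" for t
    using that by (intro cINF_lower bdd_belowI[of _ 0]) auto
  ultimately show "\<exists>C>0. \<forall>t>0. C \<le> cmod (transition M t v v)"
    by (meson order_trans)
next
  assume "\<exists>C>0. \<forall>t>0. C \<le> cmod (transition M t v v)"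
  then obtain C where "0 < C" "\<forall>t>0. C \<le> cmod (transition M t v v)" by blast
  then have "min C 1 \<le> (INF t\<in>{0<..}. cmod (transition M t v v))"
    by (intro cINF_greatest) auto
  then show "sedentary M v"
    unfolding sedentary_def using \<open>0 < C\<close> by (intro exI[of _ "min C 1"]) simp
qed

lemma sedentary_bipartite_double_iff:
  fixes A :: "real^'n^'n"
  assumes "transpose A = A"
  shows "sedentary (bipartite_double A) (c, u) \<longleftrightarrow> (\<exists>C>0. \<forall>t>0. C \<le> \<bar>Re (transition A t u u)\<bar>)"
  unfolding sedentary_iff transition_bipartite_double[OF assms] by simp

lemma Re_ge_if_cmod_ge:
  fixes z :: complex
  assumes "0 \<le> Re z" and "(Im z)\<^sup>2 \<le> Re z" and "0 \<le> C" and "C \<le> cmod z"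
  shows "min (C\<^sup>2 / 2) 1 \<le> Re z"
proof (cases "Re z \<le> 1")
  case True
  have "C\<^sup>2 \<le> (cmod z)\<^sup>2" using assms(3,4) by (intro power_mono)
  also have "\<dots> = (Re z)\<^sup>2 + (Im z)\<^sup>2" by (rule cmod_power2)
  also have "(Re z)\<^sup>2 \<le> Re z" using True assms(1) by (simp add: power2_eq_square mult_left_le_one_le)
  finally show ?thesis using assms(2) by simp
qed simp

lemma Re_transition_diag_bounded_below_if_sedentary:
  fixes A :: "real^'n^'n"
  assumes sym: "transpose A = A" and half: "eigproj A 0 $ u $ u = 1/2" and "sedentary A u"
  shows "\<exists>C>0. \<forall>t>0. C \<le> \<bar>Re (transition A t u u)\<bar>"
proof -
  obtain C where "0 < C" and C: "\<forall>t>0. C \<le> cmod (transition A t u u)"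
    using \<open>sedentary A u\<close> sedentary_iff by blast
  have "min (C\<^sup>2 / 2) 1 \<le> \<bar>Re (transition A t u u)\<bar>" if "t > 0" for t
  proof -
    have "min (C\<^sup>2 / 2) 1 \<le> Re (transition A t u u)"
      using Re_transition_diag_ge[OF sym, of u t] Im_transition_diag_squared_le_Re[OF sym half]
        C \<open>0 < C\<close> that half
      by (intro Re_ge_if_cmod_ge) auto
    then show ?thesis by linarith
  qed
  then show ?thesis using \<open>0 < C\<close> by (intro exI[of _ "min (C\<^sup>2 / 2) 1"]) simp
qed

theorem theorem27:
  fixes A :: "real^'n^'n" and u :: 'n
  assumes "weighted_graph A" and "connected_graph A" and "\<not> bipartite A"
    and "0 \<in> eigsupport A u"
  shows "(eigproj A 0 $ u $ u > 1/2 \<longrightarrow>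
            sedentary A u \<and> sedentary (bipartite_double A) (False, u)
                          \<and> sedentary (bipartite_double A) (True, u))
       \<and> (eigproj A 0 $ u $ u = 1/2 \<longrightarrow>
            (sedentary A u \<longleftrightarrow> sedentary (bipartite_double A) (False, u)
                                 \<and> sedentary (bipartite_double A) (True, u)))"
proof -
  have sym: "transpose A = A" using assms(1) unfolding weighted_graph_def by simp
  let ?e = "eigproj A 0 $ u $ u" and ?T = "\<lambda>t. transition A t u u"
  have copies: "sedentary (bipartite_double A) (c, u) \<longleftrightarrow> (\<exists>C>0. \<forall>t>0. C \<le> \<bar>Re (?T t)\<bar>)" for c
    by (rule sedentary_bipartite_double_iff[OF sym])
  have "\<exists>C>0. \<forall>t>0. C \<le> \<bar>Re (?T t)\<bar>" if "?e > 1/2"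
    using that Re_transition_diag_ge[OF sym, of u] by (intro exI[of _ "2 * ?e - 1"]) (auto intro: order_trans abs_ge_self)
  moreover have "\<exists>C>0. \<forall>t>0. C \<le> \<bar>Re (?T t)\<bar>" if "?e = 1/2" and "sedentary A u"
    using that by (rule Re_transition_diag_bounded_below_if_sedentary[OF sym])
  moreover have "sedentary A u" if "\<exists>C>0. \<forall>t>0. C \<le> \<bar>Re (?T t)\<bar>"
    using that abs_Re_le_cmod unfolding sedentary_iff by (meson order_trans)
  ultimately show ?thesis unfolding copies by blast
qed

end
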